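(* Let $K:(0,\infty)\to\mathbb{R}$ be $C^1$ and strictly decreasing with $\int_0^1 K(r)\,r\,dr<\infty$, and let $D(\Omega)=\int_\Omega\int_\Omega K(|x-y|)\,dx\,dy$. Fix an area $m>0$, and for $\alpha\in(0,\pi)$ let $I(\alpha)\subset\mathbb{R}^2$ be the isosceles triangle (unique up to congruence) with aperture $\alpha$ and area $m$. Then $\alpha\mapsto D(I(\alpha))$ is strictly increasing on $(0,\pi/3)$ and strictly decreasing on $(\pi/3,\pi)$.
   Context: The aperture of an isosceles triangle is the angle between its two equal sides. $D$ is invariant under rigid motions, so $D(I(\alpha))$ is well defined; the condition $\int_0^1K(r)r\,dr<\infty$ guarantees that $D$ is finite on bounded planar domains. *)

theory Defs
  imports "HOL-Analysis.Analysis"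
begin

text \<open>\<open>K\<close> matters on \<open>{0<..}\<close> only: the value \<open>K 0\<close> is used just on the diagonal, a null set.
  The Bochner integral is \<open>0\<close> for non-integrable functions, so this is the intended energy only
  when the integral converges.\<close>

definition interaction_energy :: "(real \<Rightarrow> real) \<Rightarrow> (real^2) set \<Rightarrow> real" where
  "interaction_energy K \<Omega> =
     set_lebesgue_integral lborel \<Omega> (\<lambda>x. set_lebesgue_integral lborel \<Omega> (\<lambda>y. K (dist x y)))"

text \<open>The angle at the vertex \<open>A\<close>, in \<open>[0, pi]\<close>; meaningful for \<open>B \<noteq> A\<close> and \<open>C \<noteq> A\<close> only.\<close>

definition angle_at :: "real^2 \<Rightarrow> real^2 \<Rightarrow> real^2 \<Rightarrow> real" where
  "angle_at A B C = arccos (((B - A) \<bullet> (C - A)) / (norm (B - A) * norm (C - A)))"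

text \<open>Aperture \<open>\<alpha>\<close> (the angle at the apex \<open>A\<close>) and area \<open>m\<close>. This determines \<open>T\<close> up to
  congruence only, hence a predicate.\<close>

definition isosceles_triangle :: "real \<Rightarrow> real \<Rightarrow> (real^2) set \<Rightarrow> bool" where
  "isosceles_triangle \<alpha> m T \<longleftrightarrow>
     (\<exists>A B C. \<not> collinear {A, B, C} \<and> T = convex hull {A, B, C} \<and>
        dist A B = dist A C \<and> angle_at A B C = \<alpha> \<and> measure lborel T = m)"

lemma isosceles_triangle_exists:
  assumes "0 < m" "0 < \<alpha>" "\<alpha> < pi"
  shows "\<exists>T. isosceles_triangle \<alpha> m T"
proof -
  have s: "sin \<alpha> > 0" using assms by (simp add: sin_gt_zero)
  define r where "r = sqrt (2 * m / sin \<alpha>)"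
  have r: "r > 0" "r\<^sup>2 * sin \<alpha> = 2 * m" using s assms by (simp_all add: r_def)
  define B C :: "real^2" where "B = vector [r, 0]" and "C = vector [r * cos \<alpha>, r * sin \<alpha>]"
  have nB: "norm B = r" using r by (simp add: B_def norm_eq_sqrt_inner inner_vec_def sum_2)
  have "(r * cos \<alpha>) * (r * cos \<alpha>) + (r * sin \<alpha>) * (r * sin \<alpha>) = r\<^sup>2 * ((sin \<alpha>)\<^sup>2 + (cos \<alpha>)\<^sup>2)"
    by algebra
  then have nC: "norm C = r" using r
    by (simp add: C_def norm_eq_sqrt_inner inner_vec_def sum_2)
  have BC: "B \<bullet> C = r\<^sup>2 * cos \<alpha>"
    by (simp add: B_def C_def inner_vec_def sum_2 power2_eq_square)
  have ang: "angle_at 0 B C = \<alpha>"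
    using r assms by (simp add: angle_at_def nB nC BC power2_eq_square arccos_cos)
  have area: "measure lborel (convex hull {0, B, C}) = m"
    using r s assms(1) by (subst content_triangle) (simp add: B_def C_def power2_eq_square algebra_simps)
  have ncol: "\<not> collinear {0, B, C}"
  proof
    assume "collinear {0, B, C}"
    then have "\<bar>B \<bullet> C\<bar> = norm B * norm C"
      by (simp add: norm_cauchy_schwarz_equal)
    then have "\<bar>cos \<alpha>\<bar> = 1"
      using r by (simp add: BC nB nC abs_mult power2_eq_square)
    then have "(cos \<alpha>)\<^sup>2 = 1" by (metis power2_abs one_power2)
    then show False using s by (simp add: cos_squared_eq)
  qed
  have "isosceles_triangle \<alpha> m (convex hull {0, B, C})"
    unfolding isosceles_triangle_def using ang area ncol nB nC
    by (intro exI[of _ 0] exI[of _ B] exI[of _ C]) simp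
  then show ?thesis by blast
qed

end

(* The energy of a triangle depends only on its area and on the Gram matrix of two edge vectors
   e, f: it is (2 area)^2 times the integral of K(sqrt(q(u,v))) G(u,v), where
   q(u,v) = |u e + v f|^2 and G is the overlap of the standard triangle with its translate by (u,v).
   A shear parallel to e keeps |e| and the determinant of q, and raises the energy if it moves
   the third vertex closer to the perpendicular bisector of its base (a Steiner symmetrization).
   Parametrize isosceles triangles of fixed area by the cotangent of the aperture. To pass from X
   to a Y nearer to cot(pi/3), shear along one leg until the other leg has its final length; the
   aperture then has cotangent Z with (1+Z^2)^2 = (1+X^2)(1+Y^2). A second shear, along
   the other leg, finishes. Both shears move a vertex towards the bisector of its base. *)

theory Submission
  imports Defs
begin

section \<open>Quadratic forms and the overlap function\<close>

definition std_triangle :: "(real \<times> real) set" where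
  "std_triangle = {p. 0 \<le> fst p \<and> 0 \<le> snd p \<and> fst p + snd p \<le> 1}"

text \<open>With \<open>T\<close> the standard triangle, this is the area of the intersection of
  \<open>T\<close> with its translate by \<open>z\<close>. The maximum is the norm whose unit ball
  is the hexagon of differences of points of \<open>T\<close>; the intersection is a copy of
  \<open>T\<close> scaled by one minus that norm.\<close>

definition std_overlap :: "real \<times> real \<Rightarrow> real" where
  "std_overlap z = (max 0 (1 - max (max \<bar>fst z\<bar> \<bar>snd z\<bar>) \<bar>fst z + snd z\<bar>))\<^sup>2 / 2"

definition qform :: "real \<Rightarrow> real \<Rightarrow> real \<Rightarrow> real \<times> real \<Rightarrow> real" where
  "qform a b d z = a * (fst z)\<^sup>2 + 2 * b * fst z * snd z + d * (snd z)\<^sup>2"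

definition form_energy :: "(real \<Rightarrow> real) \<Rightarrow> real \<Rightarrow> real \<Rightarrow> real \<Rightarrow> real" where
  "form_energy K a b d = (\<integral>z. K (sqrt (qform a b d z)) * std_overlap z \<partial>lborel)"

text \<open>Multiplying by \<open>a\<close> and completing the square leaves two squares, the second
  weighted by the determinant; one of them is positive according to whether \<open>v\<close>
  vanishes.\<close>

lemma qform_pos:
  assumes "0 < a" "b\<^sup>2 < a * d" "z \<noteq> 0"
  shows "0 < qform a b d z"
proof -
  obtain u v where z: "z = (u, v)" by force
  have *: "a * qform a b d z = (a * u + b * v)\<^sup>2 + (a * d - b\<^sup>2) * v\<^sup>2"
    by (simp add: qform_def z power2_eq_square algebra_simps)
  have "0 < a * qform a b d z"
  proof (cases "v = 0")
    case True
    then show ?thesis using assms unfolding * by (simp add: z zero_prod_def)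
  next
    case False
    then have "0 < (a * d - b\<^sup>2) * v\<^sup>2" using assms by simp
    then show ?thesis unfolding * by (smt (verit) zero_le_power2)
  qed
  then show ?thesis using assms(1) by (simp add: zero_less_mult_iff)
qed

lemma qform_measurable [measurable]: "qform a b d \<in> borel_measurable borel"
  unfolding qform_def by (intro borel_measurable_continuous_onI continuous_intros)

lemma std_overlap_measurable [measurable]: "std_overlap \<in> borel_measurable borel"
  unfolding std_overlap_def by (intro borel_measurable_continuous_onI continuous_intros) auto

lemma std_triangle_measurable [measurable]: "std_triangle \<in> sets borel"
  unfolding std_triangle_def
  by (intro borel_closed closed_Collect_conj closed_Collect_le continuous_intros)

lemma std_overlap_nonneg: "0 \<le> std_overlap z"
  unfolding std_overlap_def by (intro divide_nonneg_nonneg zero_le_power2) simp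

lemma std_overlap_swap: "std_overlap (v, u) = std_overlap (u, v)"
  unfolding std_overlap_def fst_conv snd_conv by (metis add.commute max.commute)

text \<open>For fixed \<open>v\<close> the hexagonal norm depends on \<open>u\<close> only through
  the distance from \<open>u\<close> to \<open>- v / 2\<close>, and grows with it. This symmetry
  axis is what makes a shear comparable with a Steiner symmetrization.\<close>

lemma std_overlap_antimono:
  assumes "\<bar>u + v / 2\<bar> \<le> \<bar>u' + v / 2\<bar>"
  shows "std_overlap (u', v) \<le> std_overlap (u, v)"
proof -
  define E where "E x = \<bar>x + v / 2\<bar> + \<bar>v\<bar> / 2" for x
  have N: "max (max \<bar>x\<bar> \<bar>v\<bar>) \<bar>x + v\<bar> = max \<bar>v\<bar> (E x)" for x
  proof (rule antisym)
    have "\<bar>x\<bar> \<le> E x" "\<bar>x + v\<bar> \<le> E x" by (auto simp: E_def)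
    then show "max (max \<bar>x\<bar> \<bar>v\<bar>) \<bar>x + v\<bar> \<le> max \<bar>v\<bar> (E x)"
      by (metis max.bounded_iff max.cobounded1 max.coboundedI2)
    \<comment> \<open>The numbers \<open>x\<close> and \<open>x + v\<close> are
      \<open>x + v / 2\<close> minus and plus \<open>v / 2\<close>, so the larger of their absolute
      values is exactly \<open>E x\<close>.\<close>
    have "E x \<le> \<bar>x\<bar> \<or> E x \<le> \<bar>x + v\<bar>" unfolding E_def by arith
    then show "max \<bar>v\<bar> (E x) \<le> max (max \<bar>x\<bar> \<bar>v\<bar>) \<bar>x + v\<bar>"
      by (metis max.bounded_iff max.cobounded1 max.cobounded2 max.coboundedI1 max.coboundedI2)
  qed
  have "E u \<le> E u'" using assms by (simp add: E_def)
  then have "max \<bar>v\<bar> (E u) \<le> max \<bar>v\<bar> (E u')" by (rule max.mono[OF order_refl])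
  then have "max 0 (1 - max \<bar>v\<bar> (E u')) \<le> max 0 (1 - max \<bar>v\<bar> (E u))"
    by (rule max.mono[OF order_refl diff_left_mono])
  then show ?thesis unfolding std_overlap_def fst_conv snd_conv N
    by (intro divide_right_mono power_mono) (assumption | rule max.cobounded1 zero_le_numeral)+
qed

text \<open>Each line of constant \<open>v\<close> is mapped to itself by a reflection, which
  preserves length; Fubini with \<open>u\<close> as the inner variable gives the plane.\<close>

lemma lborel_distr_skew_reflection:
  "distr lborel borel (\<lambda>z. (- fst z - s * snd z, snd z)) = (lborel :: (real \<times> real) measure)"
    (is "distr lborel borel ?R = _")
proof (rule measure_eqI)
  fix A :: "(real \<times> real) set" assume "A \<in> sets (distr lborel borel ?R)"
  then have A: "A \<in> sets borel" by simp
  have R: "?R \<in> borel_measurable borel"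
    by (intro borel_measurable_continuous_onI continuous_intros)
  have RA: "(\<lambda>z. indicator A (?R z) :: ennreal) \<in> borel_measurable (lborel \<Otimes>\<^sub>M lborel)"
    unfolding lborel_prod using R A by measurable
  have ind: "(indicator A :: _ \<Rightarrow> ennreal) \<in> borel_measurable (lborel \<Otimes>\<^sub>M lborel)"
    unfolding lborel_prod using A by measurable
  have "emeasure (distr lborel borel ?R) A = (\<integral>\<^sup>+z. indicator A z \<partial>distr lborel borel ?R)"
    using A by simp
  also have "\<dots> = (\<integral>\<^sup>+z. indicator A (?R z) \<partial>lborel)"
    using A R by (intro nn_integral_distr) simp_all
  also have "\<dots> = (\<integral>\<^sup>+v. \<integral>\<^sup>+u. indicator A (- u - s * v, v) \<partial>lborel \<partial>lborel)"
    using lborel_pair.nn_integral_snd[OF RA] by (simp add: lborel_prod)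
  also have "\<dots> = (\<integral>\<^sup>+v. \<integral>\<^sup>+u. indicator A (u, v) \<partial>lborel \<partial>lborel)"
  proof (rule nn_integral_cong)
    fix v :: real
    have uv: "(\<lambda>u::real. (u, v)) \<in> borel_measurable borel"
      by (intro borel_measurable_continuous_onI continuous_intros)
    have "(\<lambda>u. indicator A (u, v) :: ennreal) \<in> borel_measurable borel"
      using uv A by measurable
    from nn_integral_real_affine[OF this, of "-1" "- s * v"]
    show "(\<integral>\<^sup>+u. indicator A (- u - s * v, v) \<partial>lborel) = (\<integral>\<^sup>+u. indicator A (u, v) \<partial>lborel)"
      by (simp add: algebra_simps)
  qed
  also have "\<dots> = (\<integral>\<^sup>+z. indicator A z \<partial>lborel)"
    using lborel_pair.nn_integral_snd[OF ind] by (simp add: lborel_prod)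
  also have "\<dots> = emeasure lborel A" using A by simp
  finally show "emeasure (distr lborel borel ?R) A = emeasure lborel A" .
qed simp

section \<open>Bounds that make the energy integral converge\<close>

lemma std_overlap_le_indicator:
  "std_overlap z \<le> indicator ({-1<..<1} \<times> {-1<..<1}) z"
proof -
  obtain u v where z: "z = (u, v)" by force
  define N where "N = max (max \<bar>u\<bar> \<bar>v\<bar>) \<bar>u + v\<bar>"
  have G: "std_overlap z = (max 0 (1 - N))\<^sup>2 / 2"
    unfolding std_overlap_def z N_def fst_conv snd_conv ..
  have N: "\<bar>u\<bar> \<le> N" "\<bar>v\<bar> \<le> N" "0 \<le> N" by (auto simp: N_def)
  show ?thesis
  proof (cases "N < 1")
    case True
    then have "(u, v) \<in> {-1<..<1} \<times> {-1<..<1}" using N by auto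
    moreover have "(1 - N)\<^sup>2 \<le> 1" using True N by (intro power_le_one) auto
    ultimately show ?thesis using True by (simp only: G) (simp add: z max_absorb2)
  next
    case False
    then show ?thesis by (simp only: G) (simp add: max_absorb1)
  qed
qed

text \<open>Completing the square in either variable bounds the form below by a multiple of the
  square of the other. Having \<open>\<delta> \<le> 1\<close> keeps
  \<open>\<delta> * \<bar>u\<bar>\<close> below 1 when \<open>\<bar>u\<bar> < 1\<close>, inside the
  interval where the kernel is assumed integrable.\<close>

lemma qform_lower:
  assumes "0 < a" "b\<^sup>2 < a * d"
  obtains \<delta> where "0 < \<delta>" "\<delta> \<le> 1"
    "\<And>u v. \<delta> * \<bar>u\<bar> \<le> sqrt (qform a b d (u, v))" "\<And>u v. \<delta> * \<bar>v\<bar> \<le> sqrt (qform a b d (u, v))"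
proof -
  define D where "D = a * d - b\<^sup>2"
  have D: "0 < D" using assms by (simp add: D_def)
  have d: "0 < d" using assms by (smt (verit) zero_le_power2 zero_less_mult_iff)
  have eq: "d * qform a b d (u, v) = (d * v + b * u)\<^sup>2 + D * u\<^sup>2"
      "a * qform a b d (u, v) = (a * u + b * v)\<^sup>2 + D * v\<^sup>2" for u v
    by (simp_all add: qform_def D_def power2_eq_square algebra_simps)
  have lower: "sqrt (D / d) * \<bar>u\<bar> \<le> sqrt (qform a b d (u, v))"
      "sqrt (D / a) * \<bar>v\<bar> \<le> sqrt (qform a b d (u, v))" for u v
  proof -
    have "D * u\<^sup>2 \<le> d * qform a b d (u, v)" "D * v\<^sup>2 \<le> a * qform a b d (u, v)"
      unfolding eq by simp_all
    then have "D / d * u\<^sup>2 \<le> qform a b d (u, v)" "D / a * v\<^sup>2 \<le> qform a b d (u, v)"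
      using d assms(1) by (simp_all add: field_simps)
    then have "sqrt (D / d * u\<^sup>2) \<le> sqrt (qform a b d (u, v))"
      "sqrt (D / a * v\<^sup>2) \<le> sqrt (qform a b d (u, v))"
      by (simp_all only: real_sqrt_le_mono)
    then show "sqrt (D / d) * \<bar>u\<bar> \<le> sqrt (qform a b d (u, v))"
      "sqrt (D / a) * \<bar>v\<bar> \<le> sqrt (qform a b d (u, v))"
      by (simp_all only: real_sqrt_mult real_sqrt_abs)
  qed
  define \<delta> where "\<delta> = min 1 (min (sqrt (D / d)) (sqrt (D / a)))"
  have "\<delta> \<le> sqrt (D / d)" "\<delta> \<le> sqrt (D / a)" by (auto simp: \<delta>_def)
  then have "\<delta> * \<bar>u\<bar> \<le> sqrt (D / d) * \<bar>u\<bar>" "\<delta> * \<bar>v\<bar> \<le> sqrt (D / a) * \<bar>v\<bar>" for u v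
    by (simp_all add: mult_right_mono)
  then have "\<delta> * \<bar>u\<bar> \<le> sqrt (qform a b d (u, v))" "\<delta> * \<bar>v\<bar> \<le> sqrt (qform a b d (u, v))" for u v
    using lower by (meson order_trans)+
  moreover have "0 < \<delta>" "\<delta> \<le> 1" using D d assms(1) by (auto simp: \<delta>_def)
  ultimately show thesis using that by blast
qed

lemma qform_upper:
  assumes "0 < a" "0 < d" "\<bar>u\<bar> \<le> 1" "\<bar>v\<bar> \<le> 1"
  shows "qform a b d (u, v) \<le> a + 2 * \<bar>b\<bar> + d"
proof -
  have "a * u\<^sup>2 \<le> a * 1" "d * v\<^sup>2 \<le> d * 1"
    using assms by (intro mult_left_mono; simp add: abs_square_le_1)+
  moreover have "b * (u * v) \<le> \<bar>b\<bar> * 1"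
  proof -
    have "b * (u * v) \<le> \<bar>b\<bar> * (\<bar>u\<bar> * \<bar>v\<bar>)" by (metis abs_ge_self abs_mult)
    also have "\<dots> \<le> \<bar>b\<bar> * 1" using assms by (intro mult_left_mono mult_le_one) auto
    finally show ?thesis .
  qed
  ultimately show ?thesis by (simp add: qform_def)
qed

section \<open>Shear monotonicity\<close>

locale decreasing_kernel =
  fixes K :: "real \<Rightarrow> real"
  assumes measurable_K [measurable]: "K \<in> borel_measurable borel"
    and decreasing: "strict_antimono_on {0<..} K"
    and integrable_near_0: "set_integrable lborel {0<..<1} (\<lambda>r. K r * r)"
begin

lemma K_less: "0 < r \<Longrightarrow> r < s \<Longrightarrow> K s < K r"
  using decreasing by (auto simp: monotone_on_def)

text \<open>The kernel is dominated in terms of \<open>max \<bar>u\<bar> \<bar>v\<bar>\<close> instead of the Euclidean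
  norm, so that Fubini on the wedge \<open>\<bar>v\<bar> \<le> \<bar>u\<bar>\<close> replaces polar coordinates.\<close>

lemma integrable_wedge:
  assumes "0 < \<delta>" "\<delta> \<le> 1"
  shows "integrable lborel (\<lambda>(u, v). if \<bar>v\<bar> \<le> \<bar>u\<bar> \<and> \<bar>u\<bar> < 1 then \<bar>K (\<delta> * \<bar>u\<bar>)\<bar> else 0)"
    (is "integrable lborel ?w")
proof -
  define h where "h r = indicator {0<..<1} r * \<bar>K r * r\<bar>" for r :: real
  have [measurable]: "h \<in> borel_measurable borel" unfolding h_def by measurable
  have "integrable lborel h"
    using integrable_norm[OF integrable_near_0[unfolded set_integrable_def]]
    by (rule Bochner_Integration.integrable_bound) (auto simp: h_def indicator_def)
  then have h: "integrable lborel (\<lambda>u. h (0 + \<delta> * u))" "integrable lborel (\<lambda>u. h (0 + (- \<delta>) * u))"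
    using assms lborel_integrable_real_affine[of h \<delta> 0] lborel_integrable_real_affine[of h "- \<delta>" 0]
    by simp_all
  have w_eq: "?w (u, v) = (if \<bar>u\<bar> < 1 then \<bar>K (\<delta> * \<bar>u\<bar>)\<bar> else 0) * indicator {- \<bar>u\<bar>..\<bar>u\<bar>} v" for u v
    by (auto simp: indicator_def)
  have "integrable (lborel \<Otimes>\<^sub>M lborel) ?w"
  proof (rule lborel_pair.Fubini_integrable)
    show "?w \<in> borel_measurable (lborel \<Otimes>\<^sub>M lborel)" by measurable
    show "AE u in lborel. integrable lborel (\<lambda>v. ?w (u, v))"
      unfolding w_eq by simp
    \<comment> \<open>The slice of the wedge over \<open>u\<close> has length
      \<open>2 * \<bar>u\<bar>\<close>; this supplies the weight \<open>r\<close> of the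
      integrability hypothesis.\<close>
    have "(\<integral>v. norm (?w (u, v)) \<partial>lborel) = (if \<bar>u\<bar> < 1 then \<bar>K (\<delta> * \<bar>u\<bar>)\<bar> else 0) * (2 * \<bar>u\<bar>)" for u
    proof -
      have "norm (?w (u, v)) = ?w (u, v)" for v by simp
      then show ?thesis by (simp only: w_eq) simp
    qed
    moreover have "integrable lborel (\<lambda>u. (if \<bar>u\<bar> < 1 then \<bar>K (\<delta> * \<bar>u\<bar>)\<bar> else 0) * (2 * \<bar>u\<bar>))"
    proof (rule Bochner_Integration.integrable_bound)
      \<comment> \<open>Substituting \<open>r = \<delta> * \<bar>u\<bar>\<close> turns the slice
        integral into \<open>2 / \<delta> * h r\<close>. Since \<open>h\<close> vanishes on
        nonpositive numbers, the sum of the two affine substitutions covers both signs of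
        \<open>u\<close>.\<close>
      show "integrable lborel (\<lambda>u. 2 / \<delta> * (h (0 + \<delta> * u) + h (0 + (- \<delta>) * u)))"
        using h by auto
      show "AE u in lborel. norm ((if \<bar>u\<bar> < 1 then \<bar>K (\<delta> * \<bar>u\<bar>)\<bar> else 0) * (2 * \<bar>u\<bar>))
          \<le> norm (2 / \<delta> * (h (0 + \<delta> * u) + h (0 + (- \<delta>) * u)))"
      proof (intro AE_I2)
        fix u :: real
        have hn: "0 \<le> h r" for r by (simp add: h_def)
        have "(if \<bar>u\<bar> < 1 then \<bar>K (\<delta> * \<bar>u\<bar>)\<bar> else 0) * (2 * \<bar>u\<bar>) \<le> 2 / \<delta> * h (\<delta> * \<bar>u\<bar>)"
        proof (cases "u \<noteq> 0 \<and> \<bar>u\<bar> < 1")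
          case True
          then have "0 < \<delta> * \<bar>u\<bar>" "\<delta> * \<bar>u\<bar> < 1"
            using assms by (auto intro: mult_le_less_imp_less[of \<delta> 1 "\<bar>u\<bar>" 1, simplified] mult_pos_pos)
          then have "h (\<delta> * \<bar>u\<bar>) = \<bar>K (\<delta> * \<bar>u\<bar>)\<bar> * (\<delta> * \<bar>u\<bar>)"
            using assms by (simp add: h_def abs_mult)
          then show ?thesis using True assms by simp
        next
          case False
          then show ?thesis using assms hn by auto
        qed
        also have "\<dots> \<le> 2 / \<delta> * (h (\<delta> * u) + h (- \<delta> * u))"
        proof -
          have "h (\<delta> * \<bar>u\<bar>) \<le> h (\<delta> * u) + h (- \<delta> * u)"
            using hn[of "\<delta> * u"] hn[of "- \<delta> * u"] by (cases "0 \<le> u") auto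
          then show ?thesis using assms by (intro mult_left_mono) auto
        qed
        finally show "norm ((if \<bar>u\<bar> < 1 then \<bar>K (\<delta> * \<bar>u\<bar>)\<bar> else 0) * (2 * \<bar>u\<bar>))
          \<le> norm (2 / \<delta> * (h (0 + \<delta> * u) + h (0 + (- \<delta>) * u)))"
          using assms hn by (simp add: abs_mult)
      qed
    qed measurable
    ultimately show "integrable lborel (\<lambda>u. \<integral>v. norm (?w (u, v)) \<partial>lborel)" by simp
  qed
  then show ?thesis by (simp add: lborel_prod)
qed

text \<open>On the square that supports the overlap, the root of the form lies between
  \<open>\<delta>\<close> times the maximum norm and the constant \<open>R\<close>. Monotonicity
  traps the kernel between its values there, and as it may change sign both absolute values enter
  the bound: a constant, and the wedge function together with its mirror image.\<close>

lemma integrable_form_energy: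
  assumes a: "0 < a" and pos: "b\<^sup>2 < a * d"
  shows "integrable lborel (\<lambda>z. K (sqrt (qform a b d z)) * std_overlap z)"
proof -
  have d: "0 < d" using assms by (smt (verit) zero_le_power2 zero_less_mult_iff)
  obtain \<delta> where \<delta>: "0 < \<delta>" "\<delta> \<le> 1" and low:
    "\<And>u v. \<delta> * \<bar>u\<bar> \<le> sqrt (qform a b d (u, v))" "\<And>u v. \<delta> * \<bar>v\<bar> \<le> sqrt (qform a b d (u, v))"
    using qform_lower[OF a pos] by metis
  define R where "R = sqrt (a + 2 * \<bar>b\<bar> + d)"
  define Q :: "(real \<times> real) set" where "Q = {-1<..<1} \<times> {-1<..<1}"
  define w where "w = (\<lambda>(u, v). if \<bar>v\<bar> \<le> \<bar>u\<bar> \<and> \<bar>u\<bar> < 1 then \<bar>K (\<delta> * \<bar>u\<bar>)\<bar> else 0)"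
  have w: "integrable lborel w" unfolding w_def by (rule integrable_wedge[OF \<delta>])
  have w': "integrable lborel (\<lambda>(u, v). w (v, u))"
    using lborel_pair.integrable_product_swap[of w] w by (simp add: lborel_prod)
  have w_nonneg: "0 \<le> w z" for z by (auto simp: w_def split: prod.split)
  have K_antimono: "0 < r \<Longrightarrow> r \<le> s \<Longrightarrow> K s \<le> K r" for r s using K_less[of r s] by fastforce
  \<comment> \<open>The term \<open>\<bar>K 0\<bar>\<close> covers the origin, where monotonicity on
    positive arguments says nothing.\<close>
  have bound: "\<bar>K (sqrt (qform a b d (u, v)))\<bar> \<le> \<bar>K 0\<bar> + \<bar>K R\<bar> + w (u, v) + w (v, u)"
    if uv: "(u, v) \<in> Q" for u v
  proof (cases "u = 0 \<and> v = 0")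
    case True
    then show ?thesis using w_nonneg[of "(u, v)"] w_nonneg[of "(v, u)"] by (auto simp: qform_def)
  next
    case False
    define t where "t = max \<bar>u\<bar> \<bar>v\<bar>"
    have t: "0 < t" using False by (auto simp: t_def less_max_iff_disj)
    have tw: "\<bar>K (\<delta> * t)\<bar> \<le> w (u, v) + w (v, u)"
      using uv by (auto simp: t_def w_def Q_def max_def)
    have "\<delta> * t \<le> sqrt (qform a b d (u, v))" using low(1)[where u = u and v = v] low(2)[where u = u and v = v]
      by (simp add: t_def max_def)
    moreover have "sqrt (qform a b d (u, v)) \<le> R"
      unfolding R_def using qform_upper[OF a d, of u v b] uv by (auto simp: Q_def)
    moreover have "0 < \<delta> * t" using \<delta> t by simp
    ultimately have "K R \<le> K (sqrt (qform a b d (u, v)))" "K (sqrt (qform a b d (u, v))) \<le> K (\<delta> * t)"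
      using K_antimono[of "\<delta> * t" "sqrt (qform a b d (u, v))"] K_antimono[of "sqrt (qform a b d (u, v))" R] by linarith+
    then show ?thesis using tw by linarith
  qed
  show ?thesis
  proof (rule Bochner_Integration.integrable_bound)
    have "emeasure lborel Q < \<infinity>"
      unfolding Q_def by (intro emeasure_bounded_finite bounded_Times) auto
    then have "integrable lborel (indicator Q :: _ \<Rightarrow> real)"
      unfolding Q_def by (intro integrable_real_indicator) (auto simp: open_Times)
    then show "integrable lborel (\<lambda>z. (\<bar>K 0\<bar> + \<bar>K R\<bar>) * indicator Q z + w z + (\<lambda>(u, v). w (v, u)) z)"
      using w w' by (intro Bochner_Integration.integrable_add integrable_mult_right)
    show "AE z in lborel. norm (K (sqrt (qform a b d z)) * std_overlap z)
        \<le> norm ((\<bar>K 0\<bar> + \<bar>K R\<bar>) * indicator Q z + w z + (\<lambda>(u, v). w (v, u)) z)"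
    proof (intro AE_I2)
      fix z :: "real \<times> real"
      obtain u v where z: "z = (u, v)" by force
      have G: "0 \<le> std_overlap z" "std_overlap z \<le> indicator Q z"
        unfolding Q_def by (rule std_overlap_nonneg std_overlap_le_indicator)+
      have "norm (K (sqrt (qform a b d z)) * std_overlap z) = \<bar>K (sqrt (qform a b d z))\<bar> * std_overlap z"
        using G(1) by (simp add: abs_mult)
      also have "\<dots> \<le> \<bar>K (sqrt (qform a b d z))\<bar> * indicator Q z"
        using G(2) by (rule mult_left_mono) simp
      also have "\<dots> \<le> (\<bar>K 0\<bar> + \<bar>K R\<bar>) * indicator Q z + w z + w (v, u)"
        using bound[of u v] w_nonneg[of z] w_nonneg[of "(v, u)"]
        by (cases "z \<in> Q") (auto simp: z)
      finally show "norm (K (sqrt (qform a b d z)) * std_overlap z)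
          \<le> norm ((\<bar>K 0\<bar> + \<bar>K R\<bar>) * indicator Q z + w z + (\<lambda>(u, v). w (v, u)) z)"
        by (simp add: z)
    qed
  qed measurable
qed

text \<open>With \<open>R\<close> the involution that takes one form to the other, the energies differ by half the
  integral of \<open>(K (sqrt q') - K (sqrt q)) * (G - G \<circ> R)\<close>, where \<open>G\<close> is the overlap; for
  \<open>z = (u, v)\<close> both factors have the sign of \<open>v * (2 * u + s * v)\<close>, up to one common constant
  sign, so no layer-cake decomposition of \<open>K\<close> is needed.\<close>

lemma
  assumes a: "0 < a" and pos: "b\<^sup>2 < a * d" and det: "a * d - b\<^sup>2 = a * d' - b'\<^sup>2"
    and closer: "\<bar>b' - a / 2\<bar> \<le> \<bar>b - a / 2\<bar>"
  shows form_energy_shear_le: "form_energy K a b d \<le> form_energy K a b' d'"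
    and form_energy_shear_less:
      "\<bar>b' - a / 2\<bar> < \<bar>b - a / 2\<bar> \<Longrightarrow> form_energy K a b d < form_energy K a b' d'"
proof -
  have pos': "b'\<^sup>2 < a * d'" using pos det by simp
  \<comment> \<open>With this \<open>s\<close>, replacing \<open>u\<close> by
    \<open>- u - s * v\<close> turns \<open>a * u + b' * v\<close> into
    \<open>- (a * u + b * v)\<close>. As the determinants agree, the reflection \<open>R\<close>
    therefore exchanges the two forms.\<close>
  define s where "s = (b + b') / a"
  have as: "a * s = b + b'" using a by (simp add: s_def)
  define R where "R z = (- fst z - s * snd z, snd z)" for z :: "real \<times> real"
  define q q' where "q = qform a b d" and "q' = qform a b' d'"
  define f where "f z = (K (sqrt (q' z)) - K (sqrt (q z))) * (std_overlap z - std_overlap (R z))" for z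
  have [measurable]: "R \<in> borel_measurable borel" unfolding R_def
    by (intro borel_measurable_continuous_onI continuous_intros)
  have [measurable]: "q \<in> borel_measurable borel" "q' \<in> borel_measurable borel"
    by (auto simp: q_def q'_def)
  have RR: "R (R z) = z" for z by (simp add: R_def)
  have q'R: "q' (R z) = q z" for z
  proof -
    obtain u v where z: "z = (u, v)" by force
    have "a * q' (R z) = (a * u + a * s * v - b' * v)\<^sup>2 + (a * d' - b'\<^sup>2) * v\<^sup>2"
      by (simp add: q'_def qform_def R_def z power2_eq_square algebra_simps)
    also have "\<dots> = (a * u + b * v)\<^sup>2 + (a * d - b\<^sup>2) * v\<^sup>2"
      unfolding as det by (simp add: algebra_simps)
    also have "\<dots> = a * q z"
      by (simp add: q_def qform_def z power2_eq_square algebra_simps)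
    finally show ?thesis using a by simp
  qed
  have qR: "q (R z) = q' z" for z using q'R[of "R z"] by (simp add: RR)
  have q_diff: "q' (u, v) - q (u, v) = (b' - b) * (v * (2 * u + s * v))" for u v
  proof -
    have "a * (q' (u, v) - q (u, v)) = (b' - b) * (v * (2 * (a * u) + (b + b') * v))"
    proof -
      have "a * d' = a * d - b\<^sup>2 + b'\<^sup>2" using det by simp
      then have "a * (d' * v\<^sup>2) = (a * d - b\<^sup>2 + b'\<^sup>2) * v\<^sup>2" by (metis mult.assoc)
      then show ?thesis by (simp add: q_def q'_def qform_def power2_eq_square algebra_simps)
    qed
    also have "\<dots> = a * ((b' - b) * (v * (2 * u + s * v)))"
      unfolding as[symmetric] by (simp add: algebra_simps)
    finally show ?thesis using a by simp
  qed
  \<comment> \<open>The squares compare the distances to the axis \<open>- v / 2\<close> that govern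
    the overlap at \<open>R (u, v)\<close> and at \<open>(u, v)\<close>; the same factor
    \<open>v * (2 * u + s * v)\<close> appears as in \<open>q_diff\<close>.\<close>
  have R_diff: "(fst (R (u, v)) + v / 2)\<^sup>2 - (u + v / 2)\<^sup>2 = (s - 1) * (v * (2 * u + s * v))" for u v
    by (simp add: R_def power2_eq_square field_simps)
  \<comment> \<open>This translates closeness to the bisector into the sign of
    \<open>(b' - b) * (s - 1)\<close>, the product of the two constants in \<open>q_diff\<close> and
    \<open>R_diff\<close>.\<close>
  have closer_iff: "(b' - a / 2)\<^sup>2 - (b - a / 2)\<^sup>2 = a * ((b' - b) * (s - 1))"
  proof -
    have "b + b' - a = a * (s - 1)" using as by (simp add: algebra_simps)
    moreover have "(b' - a / 2)\<^sup>2 - (b - a / 2)\<^sup>2 = (b' - b) * (b + b' - a)"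
      by (simp add: power2_eq_square field_simps)
    ultimately show ?thesis by simp
  qed
  have sgn: "(b' - b) * (s - 1) \<le> 0"
  proof -
    have "a * ((b' - b) * (s - 1)) \<le> 0"
      using closer abs_le_square_iff[of "b' - a/2" "b - a/2"] closer_iff by linarith
    then show ?thesis using a by (simp only: mult_le_0_iff) linarith
  qed
  have K_q: "K (sqrt (q z)) < K (sqrt (q' z))" if "q' z < q z" for z
  proof -
    have "z \<noteq> 0" using that by (auto simp: q_def q'_def qform_def)
    then have "0 < q' z" unfolding q'_def using qform_pos[OF a pos'] by blast
    with that show ?thesis by (intro K_less) auto
  qed
  have K_q': "K (sqrt (q' z)) < K (sqrt (q z))" if "q z < q' z" for z
    using K_q[of "R z"] that by (simp add: q'R qR)
  have f_nonneg: "0 \<le> f z" for z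
  proof -
    obtain u v where z: "z = (u, v)" by force
    define w where "w = v * (2 * u + s * v)"
    obtain x where x: "R z = (x, v)" by (simp add: R_def z)
    have x2: "(x + v / 2)\<^sup>2 - (u + v / 2)\<^sup>2 = (s - 1) * w"
      using R_diff[of u v] x by (simp add: z w_def)
    have qq: "q' z - q z = (b' - b) * w" using q_diff[of u v] by (simp add: z w_def)
    consider "(b' - b) * w = 0" | "(b' - b) * w < 0" | "(b' - b) * w > 0" by linarith
    then show ?thesis
    proof cases
      case 1
      then have "q' z = q z" using qq by linarith
      then show ?thesis by (simp add: f_def)
    next
      case 2
      then have "(s - 1) * w \<ge> 0" using sgn by (fastforce simp: mult_le_0_iff mult_less_0_iff zero_le_mult_iff)
      then have "std_overlap (R z) \<le> std_overlap z" unfolding x unfolding z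
        using x2 by (intro std_overlap_antimono) (simp add: abs_le_square_iff)
      moreover have "K (sqrt (q z)) < K (sqrt (q' z))" using K_q[of z] qq 2 by simp
      ultimately show ?thesis by (simp add: f_def)
    next
      case 3
      then have "(s - 1) * w \<le> 0" using sgn by (auto simp: mult_le_0_iff zero_less_mult_iff)
      then have "std_overlap z \<le> std_overlap (R z)" unfolding x unfolding z
        using x2 by (intro std_overlap_antimono) (simp add: abs_le_square_iff)
      moreover have "K (sqrt (q' z)) < K (sqrt (q z))" using K_q'[of z] qq 3 by simp
      ultimately show ?thesis by (simp add: f_def mult_nonpos_nonpos)
    qed
  qed
  have int: "integrable lborel (\<lambda>z. K (sqrt (q z)) * std_overlap z)"
      "integrable lborel (\<lambda>z. K (sqrt (q' z)) * std_overlap z)"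
    unfolding q_def q'_def using integrable_form_energy a pos pos' by auto
  have invar: "integrable lborel (\<lambda>z. h (R z))" "(\<integral>z. h (R z) \<partial>lborel) = integral\<^sup>L lborel h"
    if "integrable lborel h" for h :: "real \<times> real \<Rightarrow> real"
  proof -
    have d: "distr lborel borel R = (lborel :: (real \<times> real) measure)"
      unfolding R_def by (rule lborel_distr_skew_reflection)
    have [measurable]: "h \<in> borel_measurable borel" using that by auto
    show "integrable lborel (\<lambda>z. h (R z))"
      using that by (subst (asm) d[symmetric], subst (asm) integrable_distr_eq) auto
    show "(\<integral>z. h (R z) \<partial>lborel) = integral\<^sup>L lborel h"
      by (subst d[symmetric], subst integral_distr) auto
  qed
  \<comment> \<open>Since \<open>R\<close> swaps \<open>q\<close> and \<open>q'\<close>, the terms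
    of the expanded \<open>f\<close> that contain \<open>std_overlap (R z)\<close> integrate to the
    same two energies as the others; hence the factor 2 in \<open>f_val\<close>.\<close>
  note i1 = invar[OF int(1), unfolded qR] and i2 = invar[OF int(2), unfolded q'R]
  have f_eq: "f = (\<lambda>z. K (sqrt (q' z)) * std_overlap z + K (sqrt (q z)) * std_overlap (R z)
      - (K (sqrt (q z)) * std_overlap z + K (sqrt (q' z)) * std_overlap (R z)))"
    by (simp add: f_def fun_eq_iff algebra_simps)
  have f_int: "integrable lborel f" unfolding f_eq using int i1 i2 by auto
  have f_val: "integral\<^sup>L lborel f = 2 * (form_energy K a b' d' - form_energy K a b d)"
    unfolding f_eq using int i1 i2 by (simp add: form_energy_def q_def q'_def)
  show le: "form_energy K a b d \<le> form_energy K a b' d'"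
  proof -
    have "0 \<le> integral\<^sup>L lborel f" by (intro integral_nonneg_AE) (simp add: f_nonneg)
    then show ?thesis using f_val by simp
  qed
  show "form_energy K a b d < form_energy K a b' d'" if strict: "\<bar>b' - a / 2\<bar> < \<bar>b - a / 2\<bar>"
  proof (rule ccontr)
    assume "\<not> form_energy K a b d < form_energy K a b' d'"
    then have "integral\<^sup>L lborel f = 0" using le f_val by simp
    then have AE: "AE z in lborel. f z = 0"
      using integral_nonneg_eq_0_iff_AE[OF f_int] f_nonneg by simp
    have ne: "b' \<noteq> b" "s \<noteq> 1"
      using strict closer_iff abs_le_square_iff[of "b - a/2" "b' - a/2"] by auto
    \<comment> \<open>The bound \<open>e\<close> is so small that on the rectangle below both a
      point and its reflection stay where the hexagonal norm is linear and less than 1, namely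
      \<open>u + v\<close> and \<open>u + s * v\<close>. There both factors of \<open>f\<close> are
      nonzero, so \<open>f\<close> cannot vanish almost everywhere.\<close>
    define e where "e = 1 / (8 * (1 + \<bar>s\<bar>))"
    have e: "0 < e" "e \<le> 1/8" "\<bar>s\<bar> * e \<le> 1/8" by (auto simp: e_def field_simps)
    have nz: "f (u, v) \<noteq> 0" if uv: "u \<in> {1/4<..<1/2}" "v \<in> {0<..<e}" for u v
    proof -
      have "\<bar>s * v\<bar> \<le> \<bar>s\<bar> * e" using uv unfolding abs_mult by (intro mult_left_mono) auto
      then have sv: "\<bar>s * v\<bar> \<le> 1/8" using e by simp
      then have "0 < v * (2 * u + s * v)" using uv by (intro mult_pos_pos) auto
      then have "q' (u, v) \<noteq> q (u, v)" using q_diff[of u v] ne by auto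
      then have "K (sqrt (q' (u, v))) \<noteq> K (sqrt (q (u, v)))"
        using K_q[of "(u, v)"] K_q'[of "(u, v)"] by linarith
      moreover have "std_overlap (u, v) = (1 - (u + v))\<^sup>2 / 2"
      proof -
        have "max (max \<bar>u\<bar> \<bar>v\<bar>) \<bar>u + v\<bar> = u + v" "u + v < 1" using uv e(2) by auto
        then show ?thesis by (simp only: std_overlap_def fst_conv snd_conv)
      qed
      moreover have "std_overlap (R (u, v)) = (1 - (u + s * v))\<^sup>2 / 2"
      proof -
        have bounds: "1/4 < u" "u < 1/2" "0 < v" "v < 1/8" using uv e(2) by auto
        have "max (max \<bar>- u - s * v\<bar> \<bar>v\<bar>) \<bar>- u - s * v + v\<bar> = u + s * v" "u + s * v < 1"
          using bounds sv by linarith+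
        then show ?thesis by (simp only: std_overlap_def R_def fst_conv snd_conv)
      qed
      moreover have "(1 - (u + v))\<^sup>2 \<noteq> (1 - (u + s * v))\<^sup>2"
      proof
        assume "(1 - (u + v))\<^sup>2 = (1 - (u + s * v))\<^sup>2"
        then have "u + v = u + s * v \<or> 2 = u + v + (u + s * v)"
          by (simp add: power2_eq_iff) linarith
        moreover have "u + v + (u + s * v) < 2" using uv e(2) sv by simp linarith
        ultimately show False using uv ne by simp
      qed
      ultimately show ?thesis by (simp add: f_def)
    qed
    have "AE z::real \<times> real in lborel. z \<notin> {1/4<..<1/2} \<times> {0<..<e}"
      using AE nz by (auto elim!: eventually_mono)
    then have "{1/4<..<1/2} \<times> {0<..<e} \<in> null_sets (lborel :: (real \<times> real) measure)"
      by (subst AE_iff_null_sets) (auto simp: open_Times)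
    then have "emeasure (lborel \<Otimes>\<^sub>M lborel) ({1/4<..<1/2::real} \<times> {0<..<e}) = 0"
      unfolding lborel_prod by (rule null_setsD1)
    then show False using e by (subst (asm) lborel.emeasure_pair_measure_Times) auto
  qed
qed

text \<open>The standard triangle is symmetric in its two coordinates. Exchanging them lets a shear
  along the second edge be treated as one along the first.\<close>

lemma form_energy_swap: "form_energy K a b d = form_energy K d b a"
proof -
  let ?g = "\<lambda>z. K (sqrt (qform a b d z)) * std_overlap z"
  have "?g \<in> borel_measurable (lborel \<Otimes>\<^sub>M lborel)"
    unfolding lborel_prod by measurable
  from lborel_pair.integral_product_swap[OF this]
  have "form_energy K a b d = (\<integral>(u, v). ?g (v, u) \<partial>lborel)"
    by (simp add: form_energy_def lborel_prod)
  also have "(\<lambda>(u, v). ?g (v, u)) = (\<lambda>z. K (sqrt (qform d b a z)) * std_overlap z)"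
  proof
    fix z :: "real \<times> real"
    obtain u v where z: "z = (u, v)" by force
    have "qform a b d (v, u) = qform d b a (u, v)" by (simp add: qform_def)
    then show "(case z of (u, v) \<Rightarrow> ?g (v, u)) = K (sqrt (qform d b a z)) * std_overlap z"
      using std_overlap_swap[of v u] by (simp add: z)
  qed
  also have "integral\<^sup>L lborel \<dots> = form_energy K d b a"
    by (simp add: form_energy_def)
  finally show ?thesis .
qed

end

section \<open>The energy of a triangle\<close>

text \<open>Lebesgue measure is determined by its values on boxes, and a box is the image under
  \<open>f\<close> of its preimage, so its volume is the preimage's times the determinant.\<close>

lemma lborel_linear_image:
  fixes f :: "real^'n::{finite,wellorder} \<Rightarrow> real^'n::_"
  assumes "linear f" "inj f"
  shows "lborel = density (distr lborel borel f) (\<lambda>_. ennreal \<bar>det (matrix f)\<bar>)"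
proof (rule lborel_eqI)
  have [measurable]: "f \<in> borel_measurable borel"
    using assms(1) by (intro borel_measurable_continuous_onI linear_continuous_on linear_conv_bounded_linear[THEN iffD1])
  obtain g where g: "linear g" "g \<circ> f = id" "f \<circ> g = id"
    using assms linear_injective_isomorphism[of f] by (metis eq_id_iff comp_apply)
  fix l u :: "real^'n::_" assume lu: "\<And>b. b \<in> Basis \<Longrightarrow> l \<bullet> b \<le> u \<bullet> b"
  have bij: "f ` (f -` box l u) = box l u"
    using g(3) by (intro surj_image_vimage_eq) (metis comp_apply id_apply surj_def)
  have vi: "f -` box l u = g ` box l u" using g by (auto simp: fun_eq_iff image_iff) metis
  have lm: "f -` box l u \<in> lmeasurable" unfolding vi
    using g(1) by (intro measurable_linear_image) auto
  have sb: "f -` box l u \<in> sets borel" using measurable_sets_borel[of f borel "box l u"] by simp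
  \<comment> \<open>Volumes of linear images are taken in the completion \<open>lebesgue\<close>; it
    agrees with \<open>lborel\<close> here because both sets are Borel.\<close>
  have "measure lebesgue (box l u) = \<bar>det (matrix f)\<bar> * measure lebesgue (f -` box l u)"
    using measure_linear_image[OF assms(1) lm] bij by simp
  moreover have "emeasure lborel (f -` box l u) = ennreal (measure lebesgue (f -` box l u))"
    using emeasure_eq_measure2[OF lm] sb by (simp add: emeasure_completion)
  moreover have "emeasure lborel (box l u) = ennreal (measure lebesgue (box l u))"
    using emeasure_eq_measure2[of "box l u" lebesgue] by (simp add: emeasure_completion)
  ultimately show "emeasure (density (distr lborel borel f) (\<lambda>_. ennreal \<bar>det (matrix f)\<bar>)) (box l u) = ennreal (\<Prod>b\<in>Basis. (u - l) \<bullet> b)"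
    using emeasure_lborel_box[OF lu] by (simp add: emeasure_density emeasure_distr nn_integral_cmult_indicator ennreal_mult)
qed simp

text \<open>This transfers integrals from \<open>real^2\<close>, where the triangles live, to pairs,
  where Fubini applies.\<close>

lemma lborel_vector_2: "lborel = distr (lborel :: (real \<times> real) measure) borel (\<lambda>p. vector [fst p, snd p] :: real^2)"
proof (rule lborel_eqI)
  have eq: "(\<lambda>p. vector [fst p, snd p] :: real^2) = (\<lambda>p. fst p *\<^sub>R axis 1 1 + snd p *\<^sub>R axis 2 1)"
    by (auto simp: fun_eq_iff vec_eq_iff forall_2 axis_def)
  have [measurable]: "(\<lambda>p. vector [fst p, snd p] :: real^2) \<in> borel_measurable borel"
    unfolding eq by (intro borel_measurable_continuous_onI continuous_intros)
  fix l u :: "real^2" assume lu: "\<And>b. b \<in> Basis \<Longrightarrow> l \<bullet> b \<le> u \<bullet> b"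
  have vi: "(\<lambda>p. vector [fst p, snd p] :: real^2) -` box l u = box (l $ 1, l $ 2) (u $ 1, u $ 2)"
    by (auto simp: set_eq_iff mem_box_cart forall_2) (auto simp: box_def Basis_prod_def)
  have Basis2: "(Basis :: (real^2) set) = {axis 1 1, axis 2 1}"
    by (auto simp: Basis_vec_def UNIV_2)
  have lu2: "l $ 1 \<le> u $ 1" "l $ 2 \<le> u $ 2"
    using lu[of "axis 1 1"] lu[of "axis 2 1"] by (simp_all add: Basis2 inner_axis)
  have pr: "(\<Prod>b\<in>Basis. (u - l) \<bullet> b) = (u $ 1 - l $ 1) * (u $ 2 - l $ 2)"
    unfolding Basis2 by (simp add: inner_axis axis_eq_axis)
  show "emeasure (distr lborel borel (\<lambda>p::real\<times>real. vector [fst p, snd p] :: real^2)) (box l u) = ennreal (\<Prod>b\<in>Basis. (u - l) \<bullet> b)"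
    using lu2 unfolding pr by (simp add: emeasure_distr vi emeasure_lborel_box_eq Basis_prod_def)
qed simp

section \<open>The overlap function as an area\<close>

text \<open>The set is a right triangle with both legs \<open>t - x0 - y0\<close>, or empty when
  this is negative, whence the truncation at 0. Its vertical slices are integrated.\<close>

lemma measure_corner_triangle:
  fixes x0 y0 t :: real
  shows "measure lborel {p. x0 \<le> fst p \<and> y0 \<le> snd p \<and> fst p + snd p \<le> t} = (max 0 (t - x0 - y0))\<^sup>2 / 2"
    (is "measure lborel ?S = _")
proof (cases "x0 \<le> t - y0")
  case False
  then have "?S = {}" by auto
  then show ?thesis using False by (simp only: measure_empty) (simp add: max_def)
next
  case True
  have "closed ?S" by (intro closed_Collect_conj closed_Collect_le continuous_intros)
  then have S: "?S \<in> sets (lborel \<Otimes>\<^sub>M lborel)" unfolding lborel_prod by simp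
  have slice: "emeasure lborel (Pair x -` ?S) = ennreal (t - y0 - x) * indicator {x0..t - y0} x" for x
  proof -
    have "Pair x -` ?S = (if x0 \<le> x then {y0..t - x} else {})" by auto
    then show ?thesis by (auto simp: indicator_def algebra_simps)
  qed
  have "emeasure lborel ?S = (\<integral>\<^sup>+x. ennreal (t - y0 - x) * indicator {x0..t - y0} x \<partial>lborel)"
    using lborel.emeasure_pair_measure_alt[OF S] unfolding lborel_prod slice .
  \<comment> \<open>The antiderivative in \<open>x\<close> is
    \<open>- (t - y0 - x)\<^sup>2 / 2\<close>, left unsimplified at both endpoints so that the
    fundamental theorem matches.\<close>
  also have "\<dots> = ennreal (- (t - y0 - (t - y0))\<^sup>2 / 2 - (- (t - y0 - x0)\<^sup>2 / 2))"
    using True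
    by (intro nn_integral_FTC_Icc) (auto intro!: derivative_eq_intros simp: field_simps)
  also have "- (t - y0 - (t - y0))\<^sup>2 / 2 - (- (t - y0 - x0)\<^sup>2 / 2) = (max 0 (t - x0 - y0))\<^sup>2 / 2"
    using True by (simp add: max_absorb2 algebra_simps)
  finally show ?thesis
    by (rule measure_eq_emeasure_eq_ennreal[rotated]) simp
qed

lemma measure_std_triangle: "measure lborel std_triangle = 1 / 2"
  using measure_corner_triangle[of 0 0 1] by (simp add: std_triangle_def)

lemma bounded_std_triangle: "bounded std_triangle"
proof -
  have "std_triangle \<subseteq> cbox (0, 0) (1, 1)" by (auto simp: std_triangle_def mem_box Basis_prod_def)
  then show ?thesis by (rule bounded_subset[OF bounded_cbox])
qed

text \<open>Membership of both \<open>p\<close> and \<open>p + z\<close> again cuts out a corner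
  triangle, with each of the three sides pushed in by a positive part. These three positive parts
  add up to the hexagonal norm of \<open>z\<close>.\<close>

lemma integral_std_overlap:
  "(\<integral>p. indicator std_triangle p * indicator std_triangle (p + z) \<partial>lborel) = std_overlap z"
proof -
  obtain u v where z: "z = (u, v)" by force
  have "(\<integral>p. indicator std_triangle p * indicator std_triangle (p + z) \<partial>lborel)
      = measure lborel {p. max 0 (- u) \<le> fst p \<and> max 0 (- v) \<le> snd p \<and> fst p + snd p \<le> 1 - max 0 (u + v)}"
    (is "_ = measure lborel ?S")
  proof -
    have "indicator std_triangle p * indicator std_triangle (p + z) = (indicator ?S p :: real)" for p
      by (auto simp: indicator_def std_triangle_def z)
    then show ?thesis by simp
  qed
  also have "\<dots> = std_overlap z"
  proof -
    have "max 0 (u + v) + max 0 (- u) + max 0 (- v) = max (max \<bar>u\<bar> \<bar>v\<bar>) \<bar>u + v\<bar>"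
      by (cases "0 \<le> u"; cases "0 \<le> v"; cases "0 \<le> u + v") (simp_all add: max_absorb1 max_absorb2)
    then have "1 - max 0 (u + v) - max 0 (- u) - max 0 (- v) = 1 - max (max \<bar>u\<bar> \<bar>v\<bar>) \<bar>u + v\<bar>"
      by linarith
    then show ?thesis
      unfolding measure_corner_triangle std_overlap_def z fst_conv snd_conv by (simp only:)
  qed
  finally show ?thesis .
qed

lemma norm_eq_sqrt_qform:
  "norm (fst p *\<^sub>R e + snd p *\<^sub>R f) = sqrt (qform (e \<bullet> e) (e \<bullet> f) (f \<bullet> f) p)"
proof -
  obtain u v where p: "p = (u, v)" by force
  have "(u *\<^sub>R e + v *\<^sub>R f) \<bullet> (u *\<^sub>R e + v *\<^sub>R f) = qform (e \<bullet> e) (e \<bullet> f) (f \<bullet> f) (u, v)"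
    by (simp add: qform_def inner_add_left inner_add_right inner_commute[of f e] power2_eq_square algebra_simps)
  then show ?thesis by (simp add: p norm_eq_sqrt_inner)
qed

text \<open>The constant is the absolute determinant of the edge vectors. It stays abstract because
  testing the formula on the indicator of a triangle identifies it as twice the area.\<close>

lemma integral_affine_chart:
  fixes A e f :: "real^2"
  assumes inj: "inj (\<lambda>p::real \<times> real. fst p *\<^sub>R e + snd p *\<^sub>R f)"
  obtains c :: real where "0 \<le> c"
    "\<And>h :: real^2 \<Rightarrow> real. h \<in> borel_measurable borel \<Longrightarrow>
      integral\<^sup>L lborel h = c * (\<integral>p. h (A + (fst p *\<^sub>R e + snd p *\<^sub>R f)) \<partial>lborel)"
proof -
  define g where "g w = (w $ 1) *\<^sub>R e + (w $ 2) *\<^sub>R f" for w :: "real^2"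
  have lin: "linear g" unfolding g_def by (intro linearI) (auto simp: algebra_simps)
  have injg: "inj g"
  proof (rule injI)
    fix w w' assume "g w = g w'"
    then have "(w $ 1, w $ 2) = (w' $ 1, w' $ 2)"
      using inj by (auto simp: g_def inj_def)
    then show "w = w'" by (simp add: vec_eq_iff forall_2)
  qed
  define c where "c = \<bar>det (matrix g)\<bar>"
  define V where "V p = (vector [fst p, snd p] :: real^2)" for p :: "real \<times> real"
  have V: "V = (\<lambda>p. fst p *\<^sub>R axis 1 1 + snd p *\<^sub>R axis 2 1)"
    by (auto simp: V_def fun_eq_iff vec_eq_iff forall_2 axis_def)
  have [measurable]: "V \<in> borel_measurable borel"
    unfolding V by (intro borel_measurable_continuous_onI continuous_intros)
  have [measurable]: "g \<in> borel_measurable borel"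
    unfolding g_def by (intro borel_measurable_continuous_onI continuous_intros)
  have gV: "g (V p) = fst p *\<^sub>R e + snd p *\<^sub>R f" for p by (simp add: g_def V_def)
  have "integral\<^sup>L lborel h = c * (\<integral>p. h (A + (fst p *\<^sub>R e + snd p *\<^sub>R f)) \<partial>lborel)"
    if [measurable]: "h \<in> borel_measurable borel" for h :: "real^2 \<Rightarrow> real"
  proof -
    have "integral\<^sup>L lborel h = integral\<^sup>L (distr lborel borel ((+) A)) h"
      by (simp add: lborel_distr_plus)
    also have "\<dots> = (\<integral>x. h (A + x) \<partial>lborel)"
      by (rule integral_distr) auto
    also have "\<dots> = (\<integral>x. h (A + x) \<partial>density (distr lborel borel g) (\<lambda>_. ennreal c))"
      unfolding c_def by (subst lborel_linear_image[OF lin injg]) (rule refl)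
    also have "\<dots> = (\<integral>x. c *\<^sub>R h (A + x) \<partial>distr lborel borel g)"
      by (rule integral_density) (auto simp: c_def)
    also have "\<dots> = (\<integral>x. c * h (A + g x) \<partial>lborel)"
      by (subst integral_distr) auto
    also have "\<dots> = (\<integral>x. c * h (A + g x) \<partial>distr lborel borel V)"
      unfolding V_def lborel_vector_2[symmetric] ..
    also have "\<dots> = (\<integral>p. c * h (A + g (V p)) \<partial>lborel)"
      by (rule integral_distr) auto
    finally show ?thesis by (simp add: gV)
  qed
  moreover have "0 \<le> c" by (simp add: c_def)
  ultimately show thesis by (rule that[rotated])
qed

lemma convex_hull_3_std_triangle:
  fixes A B C :: "'a::real_vector"
  shows "convex hull {A, B, C} = (\<lambda>p. A + (fst p *\<^sub>R (B - A) + snd p *\<^sub>R (C - A))) ` std_triangle"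
    (is "_ = ?f ` std_triangle")
proof (intro equalityI subsetI)
  fix x assume "x \<in> convex hull {A, B, C}"
  then obtain u v where "x = A + u *\<^sub>R (B - A) + v *\<^sub>R (C - A)" "0 \<le> u" "0 \<le> v" "u + v \<le> 1"
    unfolding convex_hull_3_alt by blast
  then have "x = ?f (u, v)" "(u, v) \<in> std_triangle" by (simp_all add: std_triangle_def add.assoc)
  then show "x \<in> ?f ` std_triangle" by (rule image_eqI)
next
  fix x assume "x \<in> ?f ` std_triangle"
  then obtain p where "x = ?f p" "p \<in> std_triangle" by blast
  then have "x = A + fst p *\<^sub>R (B - A) + snd p *\<^sub>R (C - A)" "0 \<le> fst p" "0 \<le> snd p" "fst p + snd p \<le> 1"
    by (simp_all add: std_triangle_def add.assoc)
  then show "x \<in> convex hull {A, B, C}"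
    unfolding convex_hull_3_alt by blast
qed

context decreasing_kernel
begin

text \<open>The affine chart is applied to both points, which gives the squared Jacobian and
  distances depending only on the difference \<open>z\<close> of the parameters. Integrating over
  the base point first then leaves the overlap as the weight of \<open>z\<close>.\<close>

lemma interaction_energy_triangle:
  fixes A B C :: "real^2"
  defines "a \<equiv> (B - A) \<bullet> (B - A)" and "b \<equiv> (B - A) \<bullet> (C - A)" and "d \<equiv> (C - A) \<bullet> (C - A)"
    and "T \<equiv> convex hull {A, B, C}"
  assumes pos: "b\<^sup>2 < a * d"
  shows "interaction_energy K T = (2 * measure lborel T)\<^sup>2 * form_energy K a b d"
proof -
  define \<phi> where "\<phi> = (\<lambda>p. fst p *\<^sub>R (B - A) + snd p *\<^sub>R (C - A))"
  have "B - A \<noteq> 0" using pos by (auto simp: a_def b_def)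
  then have a: "0 < a" by (simp add: a_def)
  have norm_\<phi>: "norm (\<phi> p) = sqrt (qform a b d p)" for p
    unfolding \<phi>_def a_def b_def d_def by (rule norm_eq_sqrt_qform)
  have \<phi>_diff: "\<phi> p - \<phi> p' = \<phi> (p - p')" for p p' by (simp add: \<phi>_def algebra_simps)
  have inj: "inj \<phi>"
  proof (rule injI)
    fix p p' assume "\<phi> p = \<phi> p'"
    then have "qform a b d (p - p') = 0" using norm_\<phi>[of "p - p'"] by (simp flip: \<phi>_diff)
    then show "p = p'" using qform_pos[OF a pos, of "p - p'"] by fastforce
  qed
  obtain c where c: "0 \<le> c" and chart: "\<And>h :: real^2 \<Rightarrow> real. h \<in> borel_measurable borel \<Longrightarrow>
      integral\<^sup>L lborel h = c * (\<integral>p. h (A + \<phi> p) \<partial>lborel)"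
    unfolding \<phi>_def
    by (rule integral_affine_chart[OF inj[unfolded \<phi>_def], of A]) (rule that[unfolded \<phi>_def])
  have T: "T = (\<lambda>p. A + \<phi> p) ` std_triangle"
    unfolding T_def convex_hull_3_std_triangle \<phi>_def ..
  have ind_T: "indicator T (A + \<phi> p) = (indicator std_triangle p :: real)" for p
  proof -
    have "A + \<phi> p \<in> T \<longleftrightarrow> p \<in> std_triangle" by (simp add: T image_iff inj_eq[OF inj])
    then show ?thesis by (simp add: indicator_def)
  qed
  have "compact T" unfolding T_def by (intro finite_imp_compact_convex_hull) auto
  then have [measurable]: "T \<in> sets borel" by (intro borel_closed compact_imp_closed)
  have cT: "c = 2 * measure lborel T"
    using chart[of "indicator T"] by (simp add: ind_T measure_std_triangle)
  define k where "k z = K (sqrt (qform a b d z))" for z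
  have [measurable]: "k \<in> borel_measurable borel" unfolding k_def by measurable
  define I :: "real \<times> real \<Rightarrow> real" where "I = indicator std_triangle"
  have [measurable]: "I \<in> borel_measurable borel" unfolding I_def by measurable
  \<comment> \<open>The inner integral is a function in its own right, with its own measurability,
    so that \<open>chart\<close> can be used a second time on the outer integral.\<close>
  define J where "J x = (\<integral>y. indicator T y * K (dist x y) \<partial>lborel)" for x
  have [measurable]: "J \<in> borel_measurable borel"
    unfolding J_def by measurable
  have J: "J (A + \<phi> p) = c * (\<integral>z. I (p + z) * k z \<partial>lborel)" for p
  proof -
    have "J (A + \<phi> p) = c * (\<integral>p'. I p' * k (p' - p) \<partial>lborel)"
      unfolding J_def by (subst chart)
        (simp_all add: ind_T k_def I_def dist_commute dist_norm \<phi>_diff flip: norm_\<phi>)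
    also have "(\<integral>p'. I p' * k (p' - p) \<partial>lborel) = (\<integral>p'. I p' * k (p' - p) \<partial>distr lborel borel ((+) p))"
      by (simp add: lborel_distr_plus)
    also have "\<dots> = (\<integral>z. I (p + z) * k z \<partial>lborel)"
      by (subst integral_distr) auto
    finally show ?thesis .
  qed
  have kG: "integrable lborel (\<lambda>z. k z * std_overlap z)"
    unfolding k_def by (rule integrable_form_energy[OF a pos])
  have overlap: "(\<integral>p. I p * I (p + z) \<partial>lborel) = std_overlap z" for z
    unfolding I_def by (rule integral_std_overlap)
  have "emeasure lborel std_triangle < \<infinity>" by (rule emeasure_bounded_finite[OF bounded_std_triangle])
  then have I_int: "integrable lborel I" unfolding I_def by (intro integrable_real_indicator) auto
  have II_int: "integrable lborel (\<lambda>p. I p * I (p + z))" for z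
    by (rule Bochner_Integration.integrable_bound[OF I_int]) (auto simp: I_def indicator_def)
  \<comment> \<open>Absolute integrability is checked with \<open>p\<close> as the inner variable:
    the integral over \<open>p\<close> is then the absolute value of the integrand of
    \<open>form_energy\<close>.\<close>
  have int: "integrable (lborel \<Otimes>\<^sub>M lborel) (\<lambda>(z, p). I p * I (p + z) * k z)"
  proof (rule lborel_pair.Fubini_integrable)
    show "(\<lambda>(z, p). I p * I (p + z) * k z) \<in> borel_measurable (lborel \<Otimes>\<^sub>M lborel)"
      by measurable
    have "(\<integral>p. norm (I p * I (p + z) * k z) \<partial>lborel) = \<bar>k z * std_overlap z\<bar>" for z
    proof -
      have "(\<integral>p. norm (I p * I (p + z) * k z) \<partial>lborel) = (\<integral>p. I p * I (p + z) * \<bar>k z\<bar> \<partial>lborel)"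
        by (intro Bochner_Integration.integral_cong) (auto simp: I_def indicator_def)
      also have "\<dots> = std_overlap z * \<bar>k z\<bar>" by (simp add: overlap)
      also have "\<dots> = \<bar>k z * std_overlap z\<bar>"
        using std_overlap_nonneg[of z] by (simp add: abs_mult)
      finally show ?thesis .
    qed
    then show "integrable lborel (\<lambda>z. \<integral>p. norm (case (z, p) of (z, p) \<Rightarrow> I p * I (p + z) * k z) \<partial>lborel)"
      using kG by simp
    show "AE z in lborel. integrable lborel (\<lambda>p. case (z, p) of (z, p) \<Rightarrow> I p * I (p + z) * k z)"
      using II_int by simp
  qed
  have "interaction_energy K T = (\<integral>x. indicator T x * J x \<partial>lborel)"
    by (simp add: interaction_energy_def set_lebesgue_integral_def J_def)
  also have "\<dots> = c * (\<integral>p. I p * (c * (\<integral>z. I (p + z) * k z \<partial>lborel)) \<partial>lborel)"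
    by (subst chart) (simp_all add: ind_T J I_def)
  also have "\<dots> = c\<^sup>2 * (\<integral>p. \<integral>z. I p * I (p + z) * k z \<partial>lborel \<partial>lborel)"
    by (simp add: power2_eq_square mult.left_commute mult.assoc)
  also have "(\<integral>p. \<integral>z. I p * I (p + z) * k z \<partial>lborel \<partial>lborel) = (\<integral>z. \<integral>p. I p * I (p + z) * k z \<partial>lborel \<partial>lborel)"
    by (rule lborel_pair.Fubini_integral[OF int])
  also have "\<dots> = form_energy K a b d"
    by (simp add: overlap form_energy_def k_def mult.commute)
  finally show ?thesis by (simp add: cT)
qed

end

section \<open>Isosceles triangles\<close>

text \<open>With \<open>t = 1 / sqrt 3\<close>, so that \<open>3 * t\<^sup>2 = 1\<close>, the
  difference of the squares of the two sides is \<open>2 * t * (X - t)\<close>. The number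
  \<open>1 / sqrt 3\<close> is the cotangent of the equilateral aperture.\<close>

lemma sqrt_one_plus_square_less:
  fixes X :: real
  assumes "1 / sqrt 3 < X"
  shows "sqrt (1 + X\<^sup>2) < X + 1 / sqrt 3"
proof -
  define t where "t = 1 / sqrt 3"
  have t: "t > 0" "3 * t\<^sup>2 = 1" "t < X" using assms by (auto simp: t_def power_divide)
  have "t\<^sup>2 < X * t" unfolding power2_eq_square using t by (intro mult_strict_right_mono) auto
  then have "1 + X\<^sup>2 < (X + t)\<^sup>2" unfolding power2_sum using t(2) by linarith
  moreover have "0 < X + t" using t by linarith
  ultimately show ?thesis unfolding t_def[symmetric] by (simp add: real_less_lsqrt)
qed

text \<open>The same difference of squares is now negative. Obtuse apertures make \<open>X\<close>
  negative, so no sign of \<open>X + t\<close> may be presumed; \<open>real_less_rsqrt\<close> asks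
  for none.\<close>

lemma sqrt_one_plus_square_greater:
  fixes X :: real
  assumes "X < 1 / sqrt 3"
  shows "X + 1 / sqrt 3 < sqrt (1 + X\<^sup>2)"
proof -
  define t where "t = 1 / sqrt 3"
  have t: "t > 0" "3 * t\<^sup>2 = 1" "X < t" using assms by (auto simp: t_def power_divide)
  have "X * t < t\<^sup>2" unfolding power2_eq_square using t by (intro mult_strict_right_mono) auto
  then have "(X + t)\<^sup>2 < 1 + X\<^sup>2" unfolding power2_sum using t(2) by linarith
  then show ?thesis unfolding t_def[symmetric] by (rule real_less_rsqrt)
qed

text \<open>A geometric mean lies between its two arguments, and the intermediate value theorem
  pulls it back. Unlike an explicit square root, this places \<open>Z\<close> between
  \<open>X\<close> and \<open>Y\<close> whatever their signs.\<close>

lemma geometric_mean_between: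
  fixes X Y :: real
  obtains Z where "1 + Z\<^sup>2 = sqrt (1 + X\<^sup>2) * sqrt (1 + Y\<^sup>2)" "min X Y \<le> Z" "Z \<le> max X Y"
proof -
  define s where "s = sqrt ((1 + X\<^sup>2) * (1 + Y\<^sup>2))"
  have "s \<in> closed_segment (1 + X\<^sup>2) (1 + Y\<^sup>2)"
  proof -
    have *: "a \<le> sqrt (a * b) \<and> sqrt (a * b) \<le> b" if "0 \<le> a" "a \<le> b" for a b :: real
      using that by (auto intro!: real_le_rsqrt real_le_lsqrt mult_mono simp: power2_eq_square)
    from *[of "1 + X\<^sup>2" "1 + Y\<^sup>2"] *[of "1 + Y\<^sup>2" "1 + X\<^sup>2"] show ?thesis
      by (auto simp: s_def closed_segment_eq_real_ivl mult.commute)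
  qed
  moreover have "continuous_on (closed_segment X Y) (\<lambda>x. 1 + x\<^sup>2)"
    by (intro continuous_intros)
  ultimately obtain Z where Z: "Z \<in> closed_segment X Y" "1 + Z\<^sup>2 = s"
    using IVT'_closed_segment_real[of s "\<lambda>x. 1 + x\<^sup>2" X Y] by blast
  have "min X Y \<le> Z" "Z \<le> max X Y"
    using Z(1) by (auto simp: closed_segment_eq_real_ivl split: if_splits)
  with Z(2) show thesis by (intro that) (simp_all add: s_def real_sqrt_mult)
qed

lemma cot_strict_antimono:
  fixes x y :: real
  assumes "0 < x" "x < y" "y < pi"
  shows "cot y < cot x"
proof -
  have "sin x > 0" "sin y > 0" "sin (y - x) > 0" using assms by (auto intro: sin_gt_zero)
  then show ?thesis by (simp add: cot_def field_simps sin_diff)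
qed

lemma cot_pi_third: "cot (pi / 3) = 1 / sqrt 3"
  by (simp add: cot_def cos_60 sin_60)

lemma sqrt_one_plus_cot_square:
  assumes "0 < \<alpha>" "\<alpha> < pi"
  shows "sqrt (1 + (cot \<alpha>)\<^sup>2) = 1 / sin \<alpha>"
proof -
  have "sin \<alpha> > 0" using assms by (rule sin_gt_zero)
  then have "1 + (cot \<alpha>)\<^sup>2 = (1 / sin \<alpha>)\<^sup>2"
    by (simp add: cot_def power_divide field_simps)
  with \<open>sin \<alpha> > 0\<close> show ?thesis by simp
qed

text \<open>With leg \<open>l\<close>, twice the area is \<open>l\<^sup>2 * sin \<alpha>\<close>,
  which determines \<open>l\<close>. Both entries of the Gram matrix then become
  \<open>2 * m\<close> times a function of the cotangent.\<close>

lemma isosceles_triangle_gram: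
  assumes "isosceles_triangle \<alpha> m T" "0 < \<alpha>" "\<alpha> < pi" "0 < m"
  obtains A B C where "T = convex hull {A, B, C}" "measure lborel T = m"
    "(B - A) \<bullet> (B - A) = 2 * m * sqrt (1 + (cot \<alpha>)\<^sup>2)" "(B - A) \<bullet> (C - A) = 2 * m * cot \<alpha>"
    "(C - A) \<bullet> (C - A) = 2 * m * sqrt (1 + (cot \<alpha>)\<^sup>2)"
proof -
  obtain A B C where ncol: "\<not> collinear {A, B, C}" and T: "T = convex hull {A, B, C}"
    and legs: "dist A B = dist A C" and angle: "angle_at A B C = \<alpha>" and area: "measure lborel T = m"
    using assms(1) by (auto simp: isosceles_triangle_def)
  define e f where "e = B - A" and "f = C - A"
  define l where "l = norm e"
  have l: "norm e = l" "norm f = l"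
    using legs by (simp_all add: l_def e_def f_def dist_norm norm_minus_commute)
  have "A \<noteq> B" using ncol by auto
  then have "l > 0" by (simp add: l_def e_def)
  have ee: "e \<bullet> e = l\<^sup>2" "f \<bullet> f = l\<^sup>2" using l by (simp_all add: dot_square_norm)
  \<comment> \<open>Cauchy-Schwarz puts the quotient in the range where \<open>cos\<close> undoes
    \<open>arccos\<close>.\<close>
  have "\<bar>(e \<bullet> f) / (l * l)\<bar> \<le> 1"
    using Cauchy_Schwarz_ineq2[of e f] \<open>l > 0\<close> by (simp add: l abs_mult)
  then have "cos \<alpha> = (e \<bullet> f) / (l * l)"
    unfolding angle[symmetric] angle_at_def e_def[symmetric] f_def[symmetric] l
    by (intro cos_arccos) linarith+
  then have ef: "e \<bullet> f = l\<^sup>2 * cos \<alpha>" using \<open>l > 0\<close> by (simp add: power2_eq_square)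
  have sin: "sin \<alpha> > 0" using assms(2,3) by (rule sin_gt_zero)
  \<comment> \<open>The determinant of the edge vectors has absolute value twice the area;
    Lagrange's identity expresses its square through the Gram matrix.\<close>
  define cross where "cross = f $ 1 * e $ 2 - e $ 1 * f $ 2"
  have "\<bar>cross\<bar> = 2 * m"
    using area unfolding T by (subst (asm) content_triangle) (simp add: cross_def e_def f_def)
  then have "(2 * m)\<^sup>2 = cross\<^sup>2" by (metis power2_abs)
  also have "\<dots> = (e \<bullet> e) * (f \<bullet> f) - (e \<bullet> f)\<^sup>2"
    by (simp add: cross_def inner_vec_def sum_2 power2_eq_square algebra_simps)
  also have "\<dots> = (l\<^sup>2 * sin \<alpha>)\<^sup>2"
    unfolding ee ef power_mult_distrib sin_squared_eq by (simp add: power2_eq_square algebra_simps)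
  finally have "2 * m = l\<^sup>2 * sin \<alpha>"
    by (rule power2_eq_imp_eq) (use assms(4) sin in simp_all)
  then have "l\<^sup>2 = 2 * m * (1 / sin \<alpha>)" using sin by (simp add: field_simps)
  moreover from this have "l\<^sup>2 * cos \<alpha> = 2 * m * cot \<alpha>" by (simp add: cot_def)
  ultimately show thesis
    using ee ef T area
    by (intro that[of A B C]) (simp_all add: sqrt_one_plus_cot_square[OF assms(2,3)] flip: e_def f_def)
qed

context decreasing_kernel
begin

text \<open>Here \<open>c\<close> stands for twice the area and \<open>X\<close> for the cotangent
  of the aperture; the form has determinant \<open>c\<^sup>2\<close> for every
  \<open>X\<close>.\<close>

definition isosceles_energy :: "real \<Rightarrow> real \<Rightarrow> real" where
  "isosceles_energy c X = form_energy K (c * sqrt (1 + X\<^sup>2)) (c * X) (c * sqrt (1 + X\<^sup>2))"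

text \<open>Up to the factor \<open>c\<close>, the Gram data run through \<open>(p, X, p)\<close>,
  \<open>(p, Z, q)\<close>, after exchanging the legs \<open>(q, Z, p)\<close>, and finally
  \<open>(q, Y, q)\<close>. The choice of \<open>Z\<close> is what keeps the determinant equal to
  \<open>c\<^sup>2\<close> in the middle.\<close>

lemma isosceles_energy_less:
  assumes c: "0 < c" and XY: "1 / sqrt 3 < Y \<and> Y < X \<or> X < Y \<and> Y < 1 / sqrt 3"
  shows "isosceles_energy c X < isosceles_energy c Y"
proof -
  obtain Z where Z: "1 + Z\<^sup>2 = sqrt (1 + X\<^sup>2) * sqrt (1 + Y\<^sup>2)" "min X Y \<le> Z" "Z \<le> max X Y"
    by (rule geometric_mean_between)
  define p q where "p = sqrt (1 + X\<^sup>2)" and "q = sqrt (1 + Y\<^sup>2)"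
  have pos: "0 < p" "0 < q" unfolding p_def q_def by (auto intro: add_pos_nonneg)
  have sq: "p * p = 1 + X\<^sup>2" "q * q = 1 + Y\<^sup>2" "p * q = 1 + Z\<^sup>2"
    using Z(1) by (simp_all add: p_def q_def)
  have det: "(c * p) * (c * p) - (c * X)\<^sup>2 = c\<^sup>2" "(c * q) * (c * q) - (c * Y)\<^sup>2 = c\<^sup>2"
    "(c * p) * (c * q) - (c * Z)\<^sup>2 = c\<^sup>2" "(c * q) * (c * p) - (c * Z)\<^sup>2 = c\<^sup>2"
  proof -
    have *: "(c * x) * (c * y) - (c * z)\<^sup>2 = c\<^sup>2 * (x * y - z\<^sup>2)" for x y z
      by (simp add: power2_eq_square algebra_simps)
    show "(c * p) * (c * p) - (c * X)\<^sup>2 = c\<^sup>2" "(c * q) * (c * q) - (c * Y)\<^sup>2 = c\<^sup>2"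
      "(c * p) * (c * q) - (c * Z)\<^sup>2 = c\<^sup>2" "(c * q) * (c * p) - (c * Z)\<^sup>2 = c\<^sup>2"
      unfolding * using sq by (simp_all add: mult.commute[of q p])
  qed
  have lt: "(c * X)\<^sup>2 < (c * p) * (c * p)" "(c * Z)\<^sup>2 < (c * q) * (c * p)"
  proof -
    have "0 < c\<^sup>2" using c by simp
    then show "(c * X)\<^sup>2 < (c * p) * (c * p)" "(c * Z)\<^sup>2 < (c * q) * (c * p)"
      using det by linarith+
  qed
  have scale: "\<bar>c * x - c * y / 2\<bar> = c * \<bar>x - y / 2\<bar>" for x y
  proof -
    have "c * x - c * y / 2 = c * (x - y / 2)" by (simp add: algebra_simps)
    then show ?thesis using c by (simp add: abs_mult)
  qed
  \<comment> \<open>The difference \<open>(X - p / 2)\<^sup>2 - (Z - p / 2)\<^sup>2\<close> factors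
    as \<open>(X - Z) * (X + Z - p)\<close>, so the first shear needs \<open>p\<close> compared with
    \<open>X + Z\<close>; likewise \<open>q\<close> with \<open>Z + Y\<close> in the second. Both
    follow because \<open>Y\<close>, and hence \<open>Z\<close>, lies on the same side of
    \<open>1 / sqrt 3\<close> as \<open>X\<close>. One shear is strict since \<open>Z\<close> cannot
    equal both \<open>X\<close> and \<open>Y\<close>.\<close>
  have closer: "\<bar>Z - p / 2\<bar> \<le> \<bar>X - p / 2\<bar>" "\<bar>Y - q / 2\<bar> \<le> \<bar>Z - q / 2\<bar>"
    and strict: "\<bar>Z - p / 2\<bar> < \<bar>X - p / 2\<bar> \<or> \<bar>Y - q / 2\<bar> < \<bar>Z - q / 2\<bar>"
  proof -
    consider "1 / sqrt 3 < Y" "Y < X" "Y \<le> Z" "Z \<le> X" | "X < Y" "Y < 1 / sqrt 3" "X \<le> Z" "Z \<le> Y"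
      using XY Z(2,3) by fastforce
    then have "\<bar>Z - p / 2\<bar> \<le> \<bar>X - p / 2\<bar> \<and> \<bar>Y - q / 2\<bar> \<le> \<bar>Z - q / 2\<bar> \<and>
        (\<bar>Z - p / 2\<bar> < \<bar>X - p / 2\<bar> \<or> \<bar>Y - q / 2\<bar> < \<bar>Z - q / 2\<bar>)"
    proof cases
      case 1
      have "p < X + 1 / sqrt 3" "q < Y + 1 / sqrt 3"
        unfolding p_def q_def using 1 by (auto intro: sqrt_one_plus_square_less)
      then have "p < X + Z" "q < Y + Y" using 1 by linarith+
      then show ?thesis using 1 by linarith
    next
      case 2
      have "X + 1 / sqrt 3 < p" "Y + 1 / sqrt 3 < q"
        unfolding p_def q_def using 2 by (auto intro: sqrt_one_plus_square_greater)
      then have "X + Z < p" "Y + Y < q" using 2 by linarith+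
      then show ?thesis using 2 by linarith
    qed
    then show "\<bar>Z - p / 2\<bar> \<le> \<bar>X - p / 2\<bar>" "\<bar>Y - q / 2\<bar> \<le> \<bar>Z - q / 2\<bar>"
      "\<bar>Z - p / 2\<bar> < \<bar>X - p / 2\<bar> \<or> \<bar>Y - q / 2\<bar> < \<bar>Z - q / 2\<bar>" by blast+
  qed
  have swap: "form_energy K (c * p) (c * Z) (c * q) = form_energy K (c * q) (c * Z) (c * p)"
    by (rule form_energy_swap)
  note first = form_energy_shear_le[of "c * p" "c * X" "c * p" "c * q" "c * Z"]
    form_energy_shear_less[of "c * p" "c * X" "c * p" "c * q" "c * Z"]
  note second = form_energy_shear_le[of "c * q" "c * Z" "c * p" "c * q" "c * Y"]
    form_energy_shear_less[of "c * q" "c * Z" "c * p" "c * q" "c * Y"]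
  have 1: "form_energy K (c * p) (c * X) (c * p) \<le> form_energy K (c * p) (c * Z) (c * q)"
    "\<bar>Z - p / 2\<bar> < \<bar>X - p / 2\<bar> \<Longrightarrow> form_energy K (c * p) (c * X) (c * p) < form_energy K (c * p) (c * Z) (c * q)"
    using first c pos lt det closer unfolding scale by simp_all
  have 2: "form_energy K (c * q) (c * Z) (c * p) \<le> form_energy K (c * q) (c * Y) (c * q)"
    "\<bar>Y - q / 2\<bar> < \<bar>Z - q / 2\<bar> \<Longrightarrow> form_energy K (c * q) (c * Z) (c * p) < form_energy K (c * q) (c * Y) (c * q)"
    using second c pos lt det closer unfolding scale by simp_all
  show ?thesis
    unfolding isosceles_energy_def p_def[symmetric] q_def[symmetric]
    using strict 1 2 swap by linarith
qed

lemma interaction_energy_isosceles: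
  assumes "isosceles_triangle \<alpha> m T" "0 < \<alpha>" "\<alpha> < pi" "0 < m"
  shows "interaction_energy K T = (2 * m)\<^sup>2 * isosceles_energy (2 * m) (cot \<alpha>)"
proof -
  obtain A B C where ABC: "T = convex hull {A, B, C}" "measure lborel T = m"
    "(B - A) \<bullet> (B - A) = 2 * m * sqrt (1 + (cot \<alpha>)\<^sup>2)" "(B - A) \<bullet> (C - A) = 2 * m * cot \<alpha>"
    "(C - A) \<bullet> (C - A) = 2 * m * sqrt (1 + (cot \<alpha>)\<^sup>2)"
    using isosceles_triangle_gram[OF assms] .
  have "((B - A) \<bullet> (C - A))\<^sup>2 < ((B - A) \<bullet> (B - A)) * ((C - A) \<bullet> (C - A))"
  proof -
    have "(2 * m * sqrt (1 + (cot \<alpha>)\<^sup>2)) * (2 * m * sqrt (1 + (cot \<alpha>)\<^sup>2)) = (2 * m)\<^sup>2 * (1 + (cot \<alpha>)\<^sup>2)"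
      by (simp add: power2_eq_square)
    also have "\<dots> = (2 * m * cot \<alpha>)\<^sup>2 + (2 * m)\<^sup>2" by (simp add: power2_eq_square algebra_simps)
    finally show ?thesis using assms(4) unfolding ABC(3-5) by simp
  qed
  from interaction_energy_triangle[OF this] show ?thesis
    unfolding ABC(3-5) isosceles_energy_def ABC(1)[symmetric] ABC(2) .
qed

end

section \<open>Kernels given on positive arguments, and the conclusion\<close>

text \<open>The assumptions concern positive arguments, whereas the locale wants a Borel function on
  the whole line; a constant is put on the rest. Choosing it to be \<open>K 0\<close> leaves the
  energy unchanged even on the diagonal.\<close>

lemma decreasing_kernel_extend:
  assumes "K C1_differentiable_on {0<..}" "strict_antimono_on {0<..} K"
    "set_integrable lborel {0<..<1} (\<lambda>r. K r * r)"
  shows "decreasing_kernel (\<lambda>r. if 0 < r then K r else K 0)"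
proof
  have "continuous_on {0<..} K" using assms(1) by (rule C1_differentiable_imp_continuous_on)
  then have [measurable]: "(\<lambda>r. indicator {0<..} r *\<^sub>R K r) \<in> borel_measurable borel"
    by (intro borel_measurable_continuous_on_indicator) auto
  have "(\<lambda>r. if 0 < r then K r else K 0) = (\<lambda>r. if 0 < r then indicator {0<..} r *\<^sub>R K r else K 0)"
    by auto
  then show "(\<lambda>r. if 0 < r then K r else K 0) \<in> borel_measurable borel" by simp
  show "strict_antimono_on {0<..} (\<lambda>r. if 0 < r then K r else K 0)"
    using assms(2) by (simp add: monotone_on_def)
  show "set_integrable lborel {0<..<1} (\<lambda>r. (if 0 < r then K r else K 0) * r)"
    using assms(3) by (subst set_integrable_cong[OF refl refl]) auto
qed

lemma interaction_energy_extend: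
  "interaction_energy (\<lambda>r. if 0 < r then K r else K 0) \<Omega> = interaction_energy K \<Omega>"
proof -
  have "(if 0 < dist x y then K (dist x y) else K 0) = K (dist x y)" for x y :: "real^2" by simp
  then show ?thesis unfolding interaction_energy_def by (simp only:)
qed

theorem corollary1p4:
  fixes K :: "real \<Rightarrow> real" and m :: real and I :: "real \<Rightarrow> (real^2) set"
  assumes "K C1_differentiable_on {0<..}"
    and "strict_antimono_on {0<..} K"
    and "set_integrable lborel {0<..<1} (\<lambda>r. K r * r)"
    and "m > 0"
    and "\<And>\<alpha>. \<alpha> \<in> {0<..<pi} \<Longrightarrow> isosceles_triangle \<alpha> m (I \<alpha>)"
  shows "strict_mono_on {0<..<pi/3} (\<lambda>\<alpha>. interaction_energy K (I \<alpha>)) \<and>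
         strict_antimono_on {pi/3<..<pi} (\<lambda>\<alpha>. interaction_energy K (I \<alpha>))"
proof -
  interpret decreasing_kernel "\<lambda>r. if 0 < r then K r else K 0"
    using assms(1-3) by (rule decreasing_kernel_extend)
  have energy: "interaction_energy K (I \<alpha>) = (2 * m)\<^sup>2 * isosceles_energy (2 * m) (cot \<alpha>)"
    if "0 < \<alpha>" "\<alpha> < pi" for \<alpha>
    using interaction_energy_isosceles[of \<alpha> m "I \<alpha>"] assms(4,5) that
    by (simp add: interaction_energy_extend)
  \<comment> \<open>The cotangent of \<open>\<beta>\<close> lies strictly between
    \<open>1 / sqrt 3\<close> and that of \<open>\<alpha>\<close>. As the cotangent decreases and
    equals \<open>1 / sqrt 3\<close> at \<open>pi / 3\<close>, \<open>\<beta>\<close> is the larger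
    angle below \<open>pi / 3\<close> and the smaller one above.\<close>
  have less: "interaction_energy K (I \<alpha>) < interaction_energy K (I \<beta>)"
    if "0 < \<alpha>" "\<alpha> < pi" "0 < \<beta>" "\<beta> < pi"
      "1 / sqrt 3 < cot \<beta> \<and> cot \<beta> < cot \<alpha> \<or> cot \<alpha> < cot \<beta> \<and> cot \<beta> < 1 / sqrt 3" for \<alpha> \<beta>
    using isosceles_energy_less[of "2 * m" "cot \<beta>" "cot \<alpha>"] that assms(4) by (simp add: energy)
  show ?thesis
  proof (intro conjI monotone_onI)
    fix \<alpha> \<beta> :: real assume "\<alpha> \<in> {0<..<pi/3}" "\<beta> \<in> {0<..<pi/3}" "\<alpha> < \<beta>"
    then show "interaction_energy K (I \<alpha>) < interaction_energy K (I \<beta>)"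
      using cot_strict_antimono[of \<alpha> \<beta>] cot_strict_antimono[of \<beta> "pi / 3"]
      by (intro less) (auto simp: cot_pi_third)
  next
    fix \<alpha> \<beta> :: real assume "\<alpha> \<in> {pi/3<..<pi}" "\<beta> \<in> {pi/3<..<pi}" "\<alpha> < \<beta>"
    moreover from this have "0 < \<alpha>" "0 < \<beta>" using pi_gt_zero by auto
    ultimately show "interaction_energy K (I \<beta>) < interaction_energy K (I \<alpha>)"
      using cot_strict_antimono[of \<alpha> \<beta>] cot_strict_antimono[of "pi / 3" \<alpha>]
      by (intro less) (auto simp: cot_pi_third)
  qed
qed

end
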